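(* Let $K$ and $L$ be two simplicial complexes, let $d=\dim(K\cap L)$, and label the vertices so that the vertex set of $K\cup L$ is $(K\cup L)_0=[n]$. Then for every subset $A\subseteq [n]$, $$|I_{A}^{d+2}\cap \Delta(K\cup L)|=|I_{A}^{d+2}\cap \Delta(K)|+|I_{A}^{d+2}\cap \Delta(L)|.$$
   Context: Simplicial complexes are finite and contain the empty set; $\dim\{\emptyset\}=-1$. For a complex $K$, $K_i=\{S\in K:|S|=i+1\}$, and $K_0$ is identified with the vertex set. $[n]=\{1,\dots,n\}$. Lexicographic order: for sets $S\ne T$ of positive integers of equal size, $S<_L T$ iff $\min(S\triangle T)\in S$. Algebraic shifting (exterior): let $K$ be a simplicial complex with vertex set contained in $[n]$ (label the vertices by positive integers if necessary). Let $V$ be a real vector space with basis $e_1,\dots,e_n$, and let $f_i=\sum_{j=1}^n\alpha_{ij}e_j$, $1\le i\le n$, where the $n^2$ real numbers $\alpha_{ij}$ are algebraically independent over $\mathbb{Q}$. For $S=\{s_1<\dots<s_k\}\subseteq[n]$ put $e_S=e_{s_1}\wedge\dots\wedge e_{s_k}$, $f_S=f_{s_1}\wedge\dots\wedge f_{s_k}$ in $\bigwedge V$, and let $\tilde f_S$ be the image of $f_S$ in $(\bigwedge V)/(e_T: T\subseteq[n],\,T\notin K)$. Then $$\Delta(K)=\{S\subseteq[n]:\ \tilde f_S\notin \mathrm{span}\{\tilde f_{S'}: |S'|=|S|,\ S'<_L S\}\}.$$ $\Delta(K)$ does not depend on the choice of the generic matrix, of $n$, or of the vertex labelling; it is a simplicial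 complex with vertex set $\{1,\dots,|K_0|\}$. For a finite set $T$ of positive integers, $\mathrm{init}_j(T)$ is the set of the $j$ smallest elements of $T$. For $i>0$ and $S\subseteq[n]$, $I_S^i=\{T\subseteq[n]: |T|=|S|+i,\ \mathrm{init}_{|S|}(T)=S\}$. *)

theory Defs
  imports "HOL-Analysis.Analysis" "HOL-Analysis.Finite_Function_Topology"
begin

section \<open>Simplicial complexes\<close>

definition abstract_simplicial_complex :: "'a set set \<Rightarrow> bool" where
  "abstract_simplicial_complex K \<longleftrightarrow>
     finite K \<and> {} \<in> K \<and> (\<forall>S\<in>K. finite S) \<and> (\<forall>S\<in>K. \<forall>T. T \<subseteq> S \<longrightarrow> T \<in> K)"

definition vertices :: "'a set set \<Rightarrow> 'a set" where
  "vertices K = {v. {v} \<in> K}"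

(* Integer-valued, because the complex {{}} has dimension -1. *)
definition complex_dim :: "'a set set \<Rightarrow> int" where
  "complex_dim K = int (Max (card ` K)) - 1"

section \<open>Orders and initial segments\<close>

definition lex_less :: "nat set \<Rightarrow> nat set \<Rightarrow> bool" where
  "lex_less S T \<longleftrightarrow> S \<noteq> T \<and> Min (sym_diff S T) \<in> S"

definition init_seg :: "nat \<Rightarrow> nat set \<Rightarrow> nat set" where
  "init_seg j T = set (take j (sorted_list_of_set T))"

(* ext_sets n i S is the family written I_S^i, with ground set [n]. *)
definition ext_sets :: "nat \<Rightarrow> nat \<Rightarrow> nat set \<Rightarrow> nat set set" where
  "ext_sets n i S = {T. T \<subseteq> {1..n} \<and> card T = card S + i \<and> init_seg (card S) T = S}"

section \<open>The exterior algebra\<close>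

text \<open>
  The exterior algebra of the real vector space with basis \<open>e\<^sub>1, \<dots>, e\<^sub>n\<close> is the free vector space
  on the elements \<open>e\<^sub>S\<close>, \<open>S \<subseteq> {1..n}\<close>; an element is stored as its finitely supported family of
  coefficients. All \<open>n\<close> share one type, and \<open>ext_alg n\<close> is the algebra for a given \<open>n\<close>.
\<close>

type_synonym ext = "nat set \<Rightarrow>\<^sub>0 real"

definition ext_alg :: "nat \<Rightarrow> ext set" where
  "ext_alg n = {x. Poly_Mapping.keys x \<subseteq> Pow {1..n}}"

definition ext_basis :: "nat set \<Rightarrow> ext" where
  "ext_basis S = Poly_Mapping.single S 1"

(* The sign of the permutation that sorts S followed by T, each listed increasingly. *)
definition shuffle_sign :: "nat set \<Rightarrow> nat set \<Rightarrow> real" where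
  "shuffle_sign S T = (- 1) ^ card {(s, t). s \<in> S \<and> t \<in> T \<and> t < s}"

definition wedge_basis :: "nat set \<Rightarrow> nat set \<Rightarrow> ext" where
  "wedge_basis S T = (if S \<inter> T = {} then shuffle_sign S T *\<^sub>R ext_basis (S \<union> T) else 0)"

definition wedge :: "ext \<Rightarrow> ext \<Rightarrow> ext" where
  "wedge x y = (\<Sum>S\<in>Poly_Mapping.keys x. \<Sum>T\<in>Poly_Mapping.keys y.
     (Poly_Mapping.lookup x S * Poly_Mapping.lookup y T) *\<^sub>R wedge_basis S T)"

definition gen_vec :: "nat \<Rightarrow> (nat \<times> nat \<Rightarrow> real) \<Rightarrow> nat \<Rightarrow> ext" where
  "gen_vec n \<alpha> i = (\<Sum>j\<in>{1..n}. \<alpha> (i, j) *\<^sub>R ext_basis {j})"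

(* ext_basis {} is the unit of the algebra, i.e. the empty wedge product. *)
definition gen_wedge :: "nat \<Rightarrow> (nat \<times> nat \<Rightarrow> real) \<Rightarrow> nat set \<Rightarrow> ext" where
  "gen_wedge n \<alpha> S = foldr (\<lambda>i x. wedge (gen_vec n \<alpha> i) x) (sorted_list_of_set S) (ext_basis {})"

section \<open>The quotient by the non-faces\<close>

definition ext_ideal :: "nat \<Rightarrow> ext set \<Rightarrow> bool" where
  "ext_ideal n I \<longleftrightarrow> I \<subseteq> ext_alg n \<and> subspace I \<and>
     (\<forall>x\<in>ext_alg n. \<forall>y\<in>I. wedge x y \<in> I \<and> wedge y x \<in> I)"

definition nonface_ideal :: "nat \<Rightarrow> nat set set \<Rightarrow> ext set" where
  "nonface_ideal n K = ext_ideal n hull (ext_basis ` {T. T \<subseteq> {1..n} \<and> T \<notin> K})"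

(* The residue class of x, as a coset. *)
definition residue_class :: "nat \<Rightarrow> nat set set \<Rightarrow> ext \<Rightarrow> ext set" where
  "residue_class n K x = {y \<in> ext_alg n. y - x \<in> nonface_ideal n K}"

section \<open>Generic matrices\<close>

text \<open>
  Polynomials over the rationals in the variables \<open>I\<close>: a monomial is a finitely supported
  exponent vector, a polynomial a finitely supported family of coefficients of monomials.
\<close>

definition poly_value :: "('i \<Rightarrow> real) \<Rightarrow> (('i \<Rightarrow>\<^sub>0 nat) \<Rightarrow>\<^sub>0 rat) \<Rightarrow> real" where
  "poly_value a p = (\<Sum>m\<in>Poly_Mapping.keys p. of_rat (Poly_Mapping.lookup p m) *
     (\<Prod>v\<in>Poly_Mapping.keys m. a v ^ Poly_Mapping.lookup m v))"

definition alg_independent_over_rat :: "'i set \<Rightarrow> ('i \<Rightarrow> real) \<Rightarrow> bool" where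
  "alg_independent_over_rat I a \<longleftrightarrow>
     (\<forall>p :: ('i \<Rightarrow>\<^sub>0 nat) \<Rightarrow>\<^sub>0 rat.
        (\<forall>m\<in>Poly_Mapping.keys p. Poly_Mapping.keys m \<subseteq> I) \<and> poly_value a p = 0 \<longrightarrow> p = 0)"

definition generic_matrix :: "nat \<Rightarrow> (nat \<times> nat \<Rightarrow> real) \<Rightarrow> bool" where
  "generic_matrix n \<alpha> \<longleftrightarrow> alg_independent_over_rat ({1..n} \<times> {1..n}) \<alpha>"

section \<open>Exterior algebraic shifting\<close>

text \<open>
  The span of residue classes in the quotient is the image of the span of representatives,
  since the quotient map is linear.
\<close>

definition alg_shift :: "nat \<Rightarrow> (nat \<times> nat \<Rightarrow> real) \<Rightarrow> nat set set \<Rightarrow> nat set set" where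
  "alg_shift n \<alpha> K = {S. S \<subseteq> {1..n} \<and>
     residue_class n K (gen_wedge n \<alpha> S) \<notin>
       residue_class n K ` span (gen_wedge n \<alpha> `
         {S'. S' \<subseteq> {1..n} \<and> card S' = card S \<and> lex_less S' S})}"

end

theory Submission
  imports Defs "Jordan_Normal_Form.Determinant"
begin

text \<open>
  Put \<open>i = d + 2\<close> and \<open>k = |A|\<close>. The sets \<open>T\<close> of size \<open>k + i\<close> whose first \<open>k\<close> elements form a set
  from a lexicographically closed family \<open>\<R>\<close> of \<open>k\<close>-sets are themselves lexicographically closed, so
  the number of them in \<open>\<Delta>(K)\<close> is the rank of their \<open>f\<^sub>T\<close> modulo the non-faces of \<open>K\<close>. As the generic
  matrix is invertible, these \<open>f\<^sub>T\<close> span the same space as the products \<open>f\<^sub>R \<and> e\<^sub>U\<close> with \<open>R \<in> \<R>\<close> and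
  \<open>|U| = i\<close>. Every basis vector occurring in such a product is indexed by a superset of \<open>U\<close>, and \<open>U\<close> is too
  big to be a face of both \<open>K\<close> and \<open>L\<close>; so modulo the non-faces of \<open>K \<union> L\<close> the product lives on faces
  of \<open>K\<close> alone or on faces of \<open>L\<close> alone, and the ranks add. Subtracting the counts for
  \<open>{R. R <\<^sub>L A}\<close> from those for \<open>{R. R \<le>\<^sub>L A}\<close> leaves exactly \<open>I\<^sub>A\<^sup>i\<close>.
\<close>

section \<open>Generic matrices are invertible\<close>

lemma keys_sum_single_subset: "Poly_Mapping.keys (\<Sum>s\<in>S. Poly_Mapping.single (m s) (c s)) \<subseteq> m ` S"
proof (induction S rule: infinite_finite_induct)
  case (insert s S)
  then show ?case
    using keys_add[of "Poly_Mapping.single (m s) (c s)" "\<Sum>s\<in>S. Poly_Mapping.single (m s) (c s)"]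
    by (auto split: if_splits)
qed auto

text \<open>Injectivity of \<open>m\<close> keeps the monomials apart, so no two coefficients are
  merged and each term is evaluated on its own.\<close>

lemma poly_value_sum_single:
  assumes "finite S" and "inj_on m S"
  shows "poly_value a (\<Sum>s\<in>S. Poly_Mapping.single (m s) (c s)) =
    (\<Sum>s\<in>S. of_rat (c s) * (\<Prod>v\<in>Poly_Mapping.keys (m s). a v ^ Poly_Mapping.lookup (m s) v))"
proof -
  let ?P = "\<Sum>s\<in>S. Poly_Mapping.single (m s) (c s)"
  let ?g = "\<lambda>u. of_rat (Poly_Mapping.lookup ?P u) * (\<Prod>v\<in>Poly_Mapping.keys u. a v ^ Poly_Mapping.lookup u v)"
  have lk: "Poly_Mapping.lookup ?P (m s) = c s" if "s \<in> S" for s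
  proof -
    have "Poly_Mapping.lookup ?P (m s) = (\<Sum>t\<in>S. if t = s then c s else 0)"
      unfolding lookup_sum
      by (rule sum.cong) (use assms that in \<open>auto simp: lookup_single when_def inj_on_def\<close>)
    then show ?thesis using assms that by simp
  qed
  have "poly_value a ?P = (\<Sum>u\<in>m ` S. ?g u)"
    unfolding poly_value_def
    by (rule sum.mono_neutral_left) (use keys_sum_single_subset[of m c S] assms in \<open>auto simp: in_keys_iff\<close>)
  also have "\<dots> = (\<Sum>s\<in>S. ?g (m s))"
    by (simp add: sum.reindex[OF assms(2)])
  also have "\<dots> = (\<Sum>s\<in>S. of_rat (c s) * (\<Prod>v\<in>Poly_Mapping.keys (m s). a v ^ Poly_Mapping.lookup (m s) v))"
    by (rule sum.cong) (simp_all add: lk)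
  finally show ?thesis .
qed

text \<open>The monomial that \<open>p\<close> contributes to the Leibniz expansion of a
  determinant, as an exponent vector. \<open>Suc\<close> passes from the 0-based indices of
  \<open>mat\<close> to the 1-based indices of \<alpha>.\<close>

definition perm_monomial :: "nat \<Rightarrow> (nat \<Rightarrow> nat) \<Rightarrow> (nat \<times> nat) \<Rightarrow>\<^sub>0 nat" where
  "perm_monomial n p = (\<Sum>i<n. Poly_Mapping.single (Suc i, Suc (p i)) 1)"

lemma lookup_perm_monomial:
  "Poly_Mapping.lookup (perm_monomial n p) v = (if v \<in> (\<lambda>i. (Suc i, Suc (p i))) ` {..<n} then 1 else 0)"
proof -
  have "Poly_Mapping.lookup (perm_monomial n p) v = (\<Sum>i<n. if (Suc i, Suc (p i)) = v then 1 else 0)"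
    unfolding perm_monomial_def lookup_sum lookup_single when_def by (rule refl)
  also have "\<dots> = card {i\<in>{..<n}. (Suc i, Suc (p i)) = v}"
    by (simp add: sum.If_cases Int_def)
  also have "\<dots> = (if v \<in> (\<lambda>i. (Suc i, Suc (p i))) ` {..<n} then 1 else 0)"
  proof (cases "v \<in> (\<lambda>i. (Suc i, Suc (p i))) ` {..<n}")
    case True
    then obtain i where "i < n" "v = (Suc i, Suc (p i))" by auto
    then have "{i\<in>{..<n}. (Suc i, Suc (p i)) = v} = {i}" by auto
    then show ?thesis using True by simp
  qed auto
  finally show ?thesis .
qed

lemma keys_perm_monomial:
  "Poly_Mapping.keys (perm_monomial n p) = (\<lambda>i. (Suc i, Suc (p i))) ` {..<n}"
  by (auto simp: in_keys_iff lookup_perm_monomial split: if_splits)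

lemma inj_on_perm_monomial: "inj_on (perm_monomial n) {p. p permutes {0..<n}}"
proof (rule inj_onI, rule ext)
  fix p q i
  assume pq: "p \<in> {p. p permutes {0..<n}}" "q \<in> {p. p permutes {0..<n}}"
    and eq: "perm_monomial n p = perm_monomial n q"
  show "p i = q i"
  proof (cases "i < n")
    case True
    then have "(Suc i, Suc (p i)) \<in> Poly_Mapping.keys (perm_monomial n q)"
      unfolding eq[symmetric] by (auto simp: keys_perm_monomial)
    then show ?thesis by (auto simp: keys_perm_monomial)
  next
    case False
    then show ?thesis using pq by (auto simp: permutes_def)
  qed
qed

text \<open>The Leibniz formula exhibits the determinant as the value at \<alpha> of a polynomial
  with coefficients 1 and -1. Distinct permutations give distinct monomials, so nothing cancels and
  the polynomial is nonzero; algebraic independence then forbids the value 0.\<close>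

lemma generic_matrix_det_nonzero:
  assumes "generic_matrix n \<alpha>"
  shows "det (mat n n (\<lambda>(i, j). \<alpha> (Suc i, Suc j))) \<noteq> 0"
proof
  let ?S = "{p. p permutes {0..<n}}"
  let ?P = "\<Sum>p\<in>?S. Poly_Mapping.single (perm_monomial n p) (signof p :: rat)"
  assume det: "det (mat n n (\<lambda>(i, j). \<alpha> (Suc i, Suc j))) = 0"
  have fin: "finite ?S" by (simp add: finite_permutations)
  have monomial_value: "(\<Prod>v\<in>Poly_Mapping.keys (perm_monomial n p). \<alpha> v ^ Poly_Mapping.lookup (perm_monomial n p) v) =
      (\<Prod>i = 0..<n. \<alpha> (Suc i, Suc (p i)))" for p
  proof -
    have "(\<Prod>v\<in>Poly_Mapping.keys (perm_monomial n p). \<alpha> v ^ Poly_Mapping.lookup (perm_monomial n p) v) =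
        (\<Prod>v\<in>Poly_Mapping.keys (perm_monomial n p). \<alpha> v)"
      by (rule prod.cong) (simp_all add: lookup_perm_monomial keys_perm_monomial)
    also have "\<dots> = (\<Prod>i<n. \<alpha> (Suc i, Suc (p i)))"
      unfolding keys_perm_monomial by (subst prod.reindex) (auto intro: inj_onI)
    finally show ?thesis by (simp add: atLeast0LessThan)
  qed
  have "poly_value \<alpha> ?P = (\<Sum>p\<in>?S. signof p * (\<Prod>i = 0..<n. \<alpha> (Suc i, Suc (p i))))"
    unfolding poly_value_sum_single[OF fin inj_on_perm_monomial] monomial_value by (simp add: of_rat_minus sign_def)
  also have "\<dots> = det (mat n n (\<lambda>(i, j). \<alpha> (Suc i, Suc j)))"
    unfolding det_def
    by (auto intro!: sum.cong prod.cong dest!: permutes_in_image)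
  finally have "poly_value \<alpha> ?P = 0" using det by simp
  moreover have "\<forall>m\<in>Poly_Mapping.keys ?P. Poly_Mapping.keys m \<subseteq> {1..n} \<times> {1..n}"
  proof
    fix m assume "m \<in> Poly_Mapping.keys ?P"
    then obtain p where "p permutes {0..<n}" "m = perm_monomial n p"
      using keys_sum_single_subset[of "perm_monomial n" signof ?S] by auto
    then show "Poly_Mapping.keys m \<subseteq> {1..n} \<times> {1..n}"
      by (auto simp: keys_perm_monomial Suc_le_eq permutes_in_image[of p "{0..<n}", simplified])
  qed
  ultimately have "?P = 0"
    using assms by (auto simp: generic_matrix_def alg_independent_over_rat_def)
  \<comment> \<open>One surviving coefficient refutes \<open>?P = 0\<close>: the diagonal monomial
    comes from the identity alone, whose sign is 1.\<close>
  moreover have "Poly_Mapping.lookup ?P (perm_monomial n id) = 1"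
  proof -
    have "id \<in> ?S" by (simp add: permutes_id)
    have "Poly_Mapping.lookup ?P (perm_monomial n id) = (\<Sum>p\<in>?S. if p = id then 1 else 0)"
      unfolding lookup_sum
    proof (rule sum.cong)
      fix p assume "p \<in> ?S"
      with \<open>id \<in> ?S\<close> have "perm_monomial n p = perm_monomial n id \<longleftrightarrow> p = id"
        using inj_on_perm_monomial[of n] by (auto simp: inj_on_def)
      then show "Poly_Mapping.lookup (Poly_Mapping.single (perm_monomial n p) (signof p :: rat)) (perm_monomial n id) = (if p = id then 1 else 0)"
        by (auto simp: lookup_single when_def)
    qed simp
    then show ?thesis using fin \<open>id \<in> ?S\<close> by simp
  qed
  ultimately show False by simp
qed

text \<open>Row \<open>j\<close> of \<open>c\<close> will serve as the coefficients that express
  \<open>ext_basis {j}\<close> through the generic vectors.\<close>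

lemma generic_matrix_left_inverse:
  assumes "generic_matrix n \<alpha>"
  obtains c where "\<And>j k. j \<in> {1..n} \<Longrightarrow> k \<in> {1..n} \<Longrightarrow>
    (\<Sum>i\<in>{1..n}. c j i * \<alpha> (i, k)) = (if j = k then 1 else 0)"
proof -
  let ?M = "mat n n (\<lambda>(i, j). \<alpha> (Suc i, Suc j))"
  have "?M \<in> Units (ring_mat TYPE(real) n ())"
    by (rule det_non_zero_imp_unit[OF _ generic_matrix_det_nonzero[OF assms]]) simp
  then obtain B where B: "B \<in> carrier_mat n n" "B * ?M = 1\<^sub>m n"
    unfolding Units_def ring_mat_def by auto
  show ?thesis
  proof
    fix j k assume jk: "j \<in> {1..n}" "k \<in> {1..n}"
    then have jk': "j - 1 < n" "k - 1 < n" by auto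
    have "(\<Sum>i\<in>{1..n}. B $$ (j - 1, i - 1) * \<alpha> (i, k)) = (\<Sum>i<n. B $$ (j - 1, i) * \<alpha> (Suc i, k))"
      by (rule sum.reindex_bij_witness[of _ Suc "\<lambda>i. i - 1"]) auto
    also have "\<dots> = (B * ?M) $$ (j - 1, k - 1)"
      using jk jk' B(1) by (auto simp: scalar_prod_def atLeast0LessThan intro!: sum.cong)
    also have "\<dots> = (if j = k then 1 else 0)"
      using jk jk' unfolding B(2) by auto
    finally show "(\<Sum>i\<in>{1..n}. B $$ (j - 1, i - 1) * \<alpha> (i, k)) = (if j = k then 1 else 0)" .
  qed
qed

section \<open>Wedge products of vectors\<close>

lemma lookup_scaleR [simp]: "Poly_Mapping.lookup (c *\<^sub>R x) k = c *\<^sub>R Poly_Mapping.lookup x k"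
proof -
  have "finite {k. c *\<^sub>R Poly_Mapping.lookup x k \<noteq> 0}"
    by (rule finite_subset[OF _ finite_keys[of x]]) (auto simp: in_keys_iff)
  then show ?thesis by (simp add: scaleR_poly_mapping_def)
qed

lemma ext_eq_sum_basis:
  assumes "finite B" and "Poly_Mapping.keys x \<subseteq> B"
  shows "x = (\<Sum>S\<in>B. Poly_Mapping.lookup x S *\<^sub>R ext_basis S)"
proof (rule poly_mapping_eqI)
  fix T
  have "Poly_Mapping.lookup (\<Sum>S\<in>B. Poly_Mapping.lookup x S *\<^sub>R ext_basis S) T
      = (\<Sum>S\<in>B. if S = T then Poly_Mapping.lookup x T else 0)"
    by (auto simp: lookup_sum ext_basis_def lookup_single when_def intro!: sum.cong)
  also have "\<dots> = Poly_Mapping.lookup x T"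
    using assms by (auto simp: in_keys_iff)
  finally show "Poly_Mapping.lookup x T = Poly_Mapping.lookup (\<Sum>S\<in>B. Poly_Mapping.lookup x S *\<^sub>R ext_basis S) T"
    by simp
qed

text \<open>Indices outside the supports contribute coefficient 0. A common index set for several
  products turns bilinearity into a termwise identity.\<close>

lemma wedge_superset:
  assumes "finite B" "finite C" "Poly_Mapping.keys x \<subseteq> B" "Poly_Mapping.keys y \<subseteq> C"
  shows "wedge x y = (\<Sum>S\<in>B. \<Sum>T\<in>C.
     (Poly_Mapping.lookup x S * Poly_Mapping.lookup y T) *\<^sub>R wedge_basis S T)"
proof -
  have "wedge x y = (\<Sum>S\<in>Poly_Mapping.keys x. \<Sum>T\<in>C.
     (Poly_Mapping.lookup x S * Poly_Mapping.lookup y T) *\<^sub>R wedge_basis S T)"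
    unfolding wedge_def using assms
    by (intro sum.cong sum.mono_neutral_left) (auto simp: in_keys_iff)
  also have "\<dots> = (\<Sum>S\<in>B. \<Sum>T\<in>C.
     (Poly_Mapping.lookup x S * Poly_Mapping.lookup y T) *\<^sub>R wedge_basis S T)"
    using assms by (intro sum.mono_neutral_left) (auto simp: in_keys_iff)
  finally show ?thesis .
qed

lemma keys_scaleR_subset: "Poly_Mapping.keys (c *\<^sub>R x) \<subseteq> Poly_Mapping.keys x"
  by (auto simp: in_keys_iff)

lemma bilinear_wedge: "bilinear wedge"
  unfolding bilinear_def
proof (intro conjI allI linearI)
  fix x y z :: ext and c :: real
  let ?B = "Poly_Mapping.keys x \<union> Poly_Mapping.keys y \<union> Poly_Mapping.keys z"
  have B: "finite ?B" by simp
  have ky: "Poly_Mapping.keys (y + z) \<subseteq> ?B" using keys_add[of y z] by auto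
  have kc: "Poly_Mapping.keys (c *\<^sub>R y) \<subseteq> ?B" using keys_scaleR_subset[of c y] by auto
  note W = wedge_superset[OF B B]
  show "wedge x (y + z) = wedge x y + wedge x z"
    using ky by (subst (1 2 3) W) (auto simp: lookup_add algebra_simps sum.distrib)
  show "wedge (y + z) x = wedge y x + wedge z x"
    using ky by (subst (1 2 3) W) (auto simp: lookup_add algebra_simps sum.distrib)
  show "wedge x (c *\<^sub>R y) = c *\<^sub>R wedge x y"
    using kc by (subst (1 2) W) (auto simp: algebra_simps scaleR_sum_right)
  show "wedge (c *\<^sub>R y) x = c *\<^sub>R wedge y x"
    using kc by (subst (1 2) W) (auto simp: algebra_simps scaleR_sum_right)
qed

lemma linear_wedge_left: "linear (\<lambda>x. wedge x y)"
  and linear_wedge_right: "linear (wedge x)"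
  using bilinear_wedge by (auto simp: bilinear_def)

lemma wedge_ext_basis: "wedge (ext_basis S) (ext_basis T) = wedge_basis S T"
  by (simp add: wedge_def ext_basis_def)

section \<open>Signs and anticommutation\<close>

lemma shuffle_sign_singleton: "shuffle_sign {j} T = (- 1) ^ card {t\<in>T. t < j}"
proof -
  have "{(s, t). s \<in> {j} \<and> t \<in> T \<and> t < s} = Pair j ` {t\<in>T. t < j}" by auto
  then show ?thesis
    by (simp add: shuffle_sign_def card_image inj_on_def)
qed

text \<open>The only possible new inversion is the pair \<open>(j, k)\<close>.\<close>

lemma shuffle_sign_insert:
  assumes "finite T" "k \<notin> T"
  shows "shuffle_sign {j} (insert k T) = (if k < j then - shuffle_sign {j} T else shuffle_sign {j} T)"
proof (cases "k < j")
  case True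
  then have "{t\<in>insert k T. t < j} = insert k {t\<in>T. t < j}" by auto
  then show ?thesis using True assms by (simp add: shuffle_sign_singleton)
next
  case False
  then have "{t\<in>insert k T. t < j} = {t\<in>T. t < j}" by auto
  then show ?thesis using False by (simp add: shuffle_sign_singleton)
qed

text \<open>With \<open>j\<close>, \<open>k\<close> distinct and outside \<open>T\<close>, both
  sides are multiples of the same basis vector, and exactly one of \<open>k < j\<close> and
  \<open>j < k\<close> adds an inversion, which gives opposite signs. In all other cases both sides
  vanish.\<close>

lemma wedge_basis_anticommute:
  assumes "finite T"
  shows "wedge (ext_basis {j}) (wedge (ext_basis {k}) (ext_basis T)) =
       - wedge (ext_basis {k}) (wedge (ext_basis {j}) (ext_basis T))"
proof -
  interpret w: linear "wedge x" for x by (rule linear_wedge_right)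
  consider "j = k" | "j \<in> T \<or> k \<in> T" "j \<noteq> k" | "j \<noteq> k" "j \<notin> T" "k \<notin> T" by blast
  then show ?thesis
  proof cases
    case 3
    then show ?thesis
      by (auto simp: wedge_ext_basis wedge_basis_def w.scaleR shuffle_sign_insert assms insert_commute)
  qed (auto simp: wedge_ext_basis wedge_basis_def w.scaleR w.zero)
qed

lemma ext_alg_finite_keys: "x \<in> ext_alg n \<Longrightarrow> S \<in> Poly_Mapping.keys x \<Longrightarrow> finite S"
  by (auto simp: ext_alg_def dest: finite_subset)

lemma subspace_supported: "subspace {x :: 'a \<Rightarrow>\<^sub>0 real. Poly_Mapping.keys x \<subseteq> A}"
proof (rule subspaceI)
  fix x y :: "'a \<Rightarrow>\<^sub>0 real" and c :: real
  assume x: "x \<in> {x. Poly_Mapping.keys x \<subseteq> A}"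
  then show "c *\<^sub>R x \<in> {x. Poly_Mapping.keys x \<subseteq> A}"
    using keys_scaleR_subset[of c x] by auto
  assume "y \<in> {x. Poly_Mapping.keys x \<subseteq> A}"
  then show "x + y \<in> {x. Poly_Mapping.keys x \<subseteq> A}"
    using x keys_add[of x y] by auto
qed simp

lemma subspace_ext_alg: "subspace (ext_alg n)"
  unfolding ext_alg_def by (rule subspace_supported)

lemma keys_wedge:
  "Poly_Mapping.keys (wedge x y) \<subseteq>
    {S \<union> T | S T. S \<in> Poly_Mapping.keys x \<and> T \<in> Poly_Mapping.keys y \<and> S \<inter> T = {}}" (is "_ \<subseteq> ?V")
proof -
  have "wedge_basis S T \<in> {z. Poly_Mapping.keys z \<subseteq> ?V}"
    if "S \<in> Poly_Mapping.keys x" "T \<in> Poly_Mapping.keys y" for S T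
    using that keys_scaleR_subset[of "shuffle_sign S T" "ext_basis (S \<union> T)"]
    by (auto simp: wedge_basis_def ext_basis_def)
  then have "wedge x y \<in> {z. Poly_Mapping.keys z \<subseteq> ?V}"
    unfolding wedge_def by (intro subspace_sum subspace_scale subspace_supported)
  then show ?thesis by simp
qed

lemma wedge_in_ext_alg: "x \<in> ext_alg n \<Longrightarrow> y \<in> ext_alg n \<Longrightarrow> wedge x y \<in> ext_alg n"
  using keys_wedge[of x y] unfolding ext_alg_def by fastforce

lemma ext_basis_in_ext_alg: "S \<subseteq> {1..n} \<Longrightarrow> ext_basis S \<in> ext_alg n"
  by (simp add: ext_alg_def ext_basis_def)

lemma keys_gen_vec: "Poly_Mapping.keys (gen_vec n \<alpha> i) \<subseteq> (\<lambda>j. {j}) ` {1..n}"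
proof -
  have "gen_vec n \<alpha> i \<in> {z. Poly_Mapping.keys z \<subseteq> (\<lambda>j. {j}) ` {1..n}}"
    unfolding gen_vec_def
    by (intro subspace_sum subspace_scale subspace_supported) (simp add: ext_basis_def)
  then show ?thesis by simp
qed

lemma gen_vec_in_ext_alg: "gen_vec n \<alpha> i \<in> ext_alg n"
  using keys_gen_vec[of n \<alpha> i] by (auto simp: ext_alg_def)

lemma wedge_singletons_anticommute:
  assumes "x \<in> ext_alg n"
  shows "wedge (ext_basis {j}) (wedge (ext_basis {k}) x) =
       - wedge (ext_basis {k}) (wedge (ext_basis {j}) x)"
proof -
  interpret w: linear "wedge y" for y by (rule linear_wedge_right)
  have expand: "wedge (ext_basis {j}) (wedge (ext_basis {k}) x) = (\<Sum>S\<in>Poly_Mapping.keys x.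
      Poly_Mapping.lookup x S *\<^sub>R wedge (ext_basis {j}) (wedge (ext_basis {k}) (ext_basis S)))" for j k
    by (subst ext_eq_sum_basis[of "Poly_Mapping.keys x" x]) (simp_all add: w.sum w.scaleR)
  show ?thesis
    unfolding expand sum_negf[symmetric]
    by (intro sum.cong refl, subst wedge_basis_anticommute)
      (auto intro: ext_alg_finite_keys[OF assms])
qed

lemma gen_vec_anticommute:
  assumes "x \<in> ext_alg n"
  shows "wedge (gen_vec n \<alpha> i) (wedge (gen_vec n \<alpha> j) x) =
       - wedge (gen_vec n \<alpha> j) (wedge (gen_vec n \<alpha> i) x)"
proof -
  interpret r: linear "wedge y" for y by (rule linear_wedge_right)
  interpret l: linear "\<lambda>y. wedge y z" for z by (rule linear_wedge_left)
  have expand: "wedge (gen_vec n \<alpha> i) (wedge (gen_vec n \<alpha> j) x) =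
      (\<Sum>k\<in>{1..n}. \<Sum>l\<in>{1..n}. (\<alpha> (i, k) * \<alpha> (j, l)) *\<^sub>R wedge (ext_basis {k}) (wedge (ext_basis {l}) x))" for i j
    by (simp add: gen_vec_def r.sum r.scaleR l.sum l.scaleR scaleR_sum_right)
      (subst sum.swap, simp add: mult.commute)
  have "wedge (gen_vec n \<alpha> i) (wedge (gen_vec n \<alpha> j) x) =
      (\<Sum>k\<in>{1..n}. \<Sum>l\<in>{1..n}. (\<alpha> (i, k) * \<alpha> (j, l)) *\<^sub>R - wedge (ext_basis {l}) (wedge (ext_basis {k}) x))"
    unfolding expand by (intro sum.cong refl, subst wedge_singletons_anticommute[OF assms]) (rule refl)
  also have "\<dots> = - (\<Sum>k\<in>{1..n}. \<Sum>l\<in>{1..n}. (\<alpha> (i, k) * \<alpha> (j, l)) *\<^sub>R wedge (ext_basis {l}) (wedge (ext_basis {k}) x))"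
    by (simp add: sum_negf)
  also have "\<dots> = - wedge (gen_vec n \<alpha> j) (wedge (gen_vec n \<alpha> i) x)"
    unfolding expand by (subst sum.swap) (simp add: mult.commute)
  finally show ?thesis .
qed

lemma gen_vec_square:
  assumes "x \<in> ext_alg n"
  shows "wedge (gen_vec n \<alpha> i) (wedge (gen_vec n \<alpha> i) x) = 0"
proof -
  have "wedge (gen_vec n \<alpha> i) (wedge (gen_vec n \<alpha> i) x) +
      wedge (gen_vec n \<alpha> i) (wedge (gen_vec n \<alpha> i) x) = 0"
    using gen_vec_anticommute[OF assms, of \<alpha> i i] by (simp add: eq_neg_iff_add_eq_0)
  then show ?thesis
    by (metis scaleR_2 scaleR_eq_0_iff zero_neq_numeral)
qed

section \<open>Words in the generic vectors\<close>

text \<open>Products nest to the right, so anticommutation acts on the two outermost factors. The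
  free last factor \<open>y\<close> lets one notion cover both \<open>f_S\<close> (with
  \<open>y\<close> the unit) and the mixed products \<open>f_R \<and> e_U\<close>; letters may be
  unsorted or repeated.\<close>

definition word :: "nat \<Rightarrow> (nat \<times> nat \<Rightarrow> real) \<Rightarrow> nat list \<Rightarrow> ext \<Rightarrow> ext" where
  "word n \<alpha> xs y = foldr (\<lambda>i. wedge (gen_vec n \<alpha> i)) xs y"

lemma word_simps [simp]:
  "word n \<alpha> [] y = y"
  "word n \<alpha> (i # xs) y = wedge (gen_vec n \<alpha> i) (word n \<alpha> xs y)"
  "word n \<alpha> (xs @ ys) y = word n \<alpha> xs (word n \<alpha> ys y)"
  by (simp_all add: word_def)

lemma gen_wedge_eq_word: "gen_wedge n \<alpha> S = word n \<alpha> (sorted_list_of_set S) (ext_basis {})"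
  by (simp add: gen_wedge_def word_def)

lemma linear_word: "linear (word n \<alpha> xs)"
proof (induction xs)
  case Nil
  show ?case by (simp add: linear_iff)
next
  case (Cons i xs)
  have "word n \<alpha> (i # xs) = wedge (gen_vec n \<alpha> i) \<circ> word n \<alpha> xs" by auto
  then show ?case using linear_compose[OF Cons linear_wedge_right] by metis
qed

lemma word_in_ext_alg: "y \<in> ext_alg n \<Longrightarrow> word n \<alpha> xs y \<in> ext_alg n"
  by (induction xs) (auto intro: wedge_in_ext_alg gen_vec_in_ext_alg)

text \<open>Each smaller letter that the new one passes costs a sign. The scalar is left
  unspecified, since the result is used for membership in spans.\<close>

lemma word_insort:
  assumes "y \<in> ext_alg n"
  shows "\<exists>c. word n \<alpha> (j # xs) y = c *\<^sub>R word n \<alpha> (insort j xs) y"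
proof (induction xs)
  case Nil
  show ?case by (auto intro: exI[of _ 1])
next
  case (Cons a xs)
  interpret r: linear "wedge z" for z by (rule linear_wedge_right)
  obtain c where "word n \<alpha> (j # xs) y = c *\<^sub>R word n \<alpha> (insort j xs) y"
    using Cons by blast
  then have "word n \<alpha> (j # a # xs) y = (- c) *\<^sub>R word n \<alpha> (a # insort j xs) y"
    using gen_vec_anticommute[OF word_in_ext_alg[OF assms], of \<alpha> j a \<alpha> xs] by (simp add: r.scaleR)
  then show ?case by (cases "j \<le> a") (simp_all add: exI[of _ 1] exI[of _ "- c"])
qed

text \<open>The letter \<open>j\<close> is moved inwards until it meets its copy, where the square
  vanishes.\<close>

lemma word_repeated:
  assumes "y \<in> ext_alg n" and "j \<in> set xs"
  shows "word n \<alpha> (j # xs) y = 0"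
  using assms(2)
proof (induction xs)
  case (Cons a xs)
  interpret r: linear "wedge z" for z by (rule linear_wedge_right)
  show ?case
  proof (cases "a = j")
    case True
    then show ?thesis using gen_vec_square[OF word_in_ext_alg[OF assms(1)]] by simp
  next
    case False
    then have "word n \<alpha> (j # xs) y = 0" using Cons by simp
    then show ?thesis
      using gen_vec_anticommute[OF word_in_ext_alg[OF assms(1)], of \<alpha> j a \<alpha> xs] by (simp add: r.zero)
  qed
qed simp

lemma word_not_distinct:
  assumes "y \<in> ext_alg n" and "\<not> distinct xs"
  shows "word n \<alpha> xs y = 0"
  using assms(2)
proof (induction xs)
  case (Cons j xs)
  interpret r: linear "wedge z" for z by (rule linear_wedge_right)
  show ?case
  proof (cases "distinct xs")
    case True
    then show ?thesis using Cons word_repeated[OF assms(1)] by auto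
  next
    case False
    then show ?thesis using Cons by (simp add: r.zero)
  qed
qed simp

lemma word_sort:
  assumes "y \<in> ext_alg n"
  shows "distinct xs \<Longrightarrow> \<exists>c. word n \<alpha> xs y = c *\<^sub>R word n \<alpha> (sorted_list_of_set (set xs)) y"
proof (induction xs)
  case Nil
  show ?case by (auto intro: exI[of _ 1])
next
  case (Cons j xs)
  interpret r: linear "wedge z" for z by (rule linear_wedge_right)
  obtain c where "word n \<alpha> xs y = c *\<^sub>R word n \<alpha> (sorted_list_of_set (set xs)) y"
    using Cons by auto
  then have "word n \<alpha> (j # xs) y = c *\<^sub>R word n \<alpha> (j # sorted_list_of_set (set xs)) y"
    by (simp add: r.scaleR)
  moreover obtain c' where "word n \<alpha> (j # sorted_list_of_set (set xs)) y =
      c' *\<^sub>R word n \<alpha> (insort j (sorted_list_of_set (set xs))) y"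
    using word_insort[OF assms] by blast
  moreover have "insort j (sorted_list_of_set (set xs)) = sorted_list_of_set (set (j # xs))"
    using Cons.prems by simp
  ultimately show ?case by (metis scaleR_scaleR)
qed

text \<open>Each letter adjoins exactly one new element to every support set. For
  \<open>y = ext_basis {}\<close> this fixes the degree; for \<open>y = ext_basis U\<close> it shows
  that all support sets contain \<open>U\<close>, which later separates \<open>K\<close> from
  \<open>L\<close>.\<close>

lemma keys_word:
  assumes "S \<in> Poly_Mapping.keys (word n \<alpha> xs y)" and "\<And>T. T \<in> Poly_Mapping.keys y \<Longrightarrow> finite T"
  shows "\<exists>T\<in>Poly_Mapping.keys y. T \<subseteq> S \<and> card S = length xs + card T \<and> finite S"
  using assms(1)
proof (induction xs arbitrary: S)
  case Nil
  then show ?case using assms(2) by auto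
next
  case (Cons i xs)
  then obtain S1 S2 where "S1 \<in> Poly_Mapping.keys (gen_vec n \<alpha> i)"
    and S2: "S2 \<in> Poly_Mapping.keys (word n \<alpha> xs y)" and S: "S = S1 \<union> S2" "S1 \<inter> S2 = {}"
    using keys_wedge[of "gen_vec n \<alpha> i" "word n \<alpha> xs y"] by auto
  then obtain v where "S1 = {v}" using keys_gen_vec by blast
  moreover obtain T where "T \<in> Poly_Mapping.keys y" "T \<subseteq> S2" "card S2 = length xs + card T" "finite S2"
    using Cons.IH[OF S2] by blast
  ultimately show ?case using S by auto
qed

section \<open>Expanding basis vectors in generic vectors\<close>

lemma ext_basis_singleton_gen_vec:
  assumes c: "\<And>k. k \<in> {1..n} \<Longrightarrow> (\<Sum>i\<in>{1..n}. c i * \<alpha> (i, k)) = (if j = k then 1 else 0)"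
    and "j \<in> {1..n}"
  shows "ext_basis {j} = (\<Sum>i\<in>{1..n}. c i *\<^sub>R gen_vec n \<alpha> i)"
proof -
  have "(\<Sum>i\<in>{1..n}. c i *\<^sub>R gen_vec n \<alpha> i) =
      (\<Sum>k\<in>{1..n}. (\<Sum>i\<in>{1..n}. c i * \<alpha> (i, k)) *\<^sub>R ext_basis {k})"
    unfolding gen_vec_def scaleR_sum_right scaleR_sum_left by (subst sum.swap) simp
  also have "\<dots> = (\<Sum>k\<in>{1..n}. if k = j then ext_basis {j} else 0)"
    by (rule sum.cong, simp, subst c) auto
  finally show ?thesis using assms(2) by simp
qed

text \<open>Induction on \<open>U\<close>: the factor \<open>ext_basis {j}\<close> is replaced by
  its combination of generic vectors, which lengthens every word by one letter.\<close>

lemma ext_basis_in_span_words: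
  assumes c: "\<And>j k. j \<in> {1..n} \<Longrightarrow> k \<in> {1..n} \<Longrightarrow>
      (\<Sum>i\<in>{1..n}. c j i * \<alpha> (i, k)) = (if j = k then 1 else 0)"
    and "U \<subseteq> {1..n}"
  shows "ext_basis U \<in> span {word n \<alpha> xs (ext_basis {}) | xs. set xs \<subseteq> {1..n} \<and> length xs = card U}"
proof -
  let ?W = "\<lambda>m. {word n \<alpha> xs (ext_basis {}) | xs. set xs \<subseteq> {1..n} \<and> length xs = m}"
  have "finite U" using assms(2) finite_subset by blast
  then show ?thesis using assms(2)
  proof (induction U)
    case empty
    show ?case by (rule span_base) auto
  next
    case (insert j U)
    interpret r: linear "wedge z" for z by (rule linear_wedge_right)
    interpret l: linear "\<lambda>y. wedge y z" for z by (rule linear_wedge_left)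
    have j: "ext_basis {j} = (\<Sum>i\<in>{1..n}. c j i *\<^sub>R gen_vec n \<alpha> i)"
      by (rule ext_basis_singleton_gen_vec[of n "c j" \<alpha> j]) (use c insert.prems in auto)
    have step: "wedge (ext_basis {j}) w \<in> span (?W (Suc (card U)))" if w: "w \<in> ?W (card U)" for w
    proof -
      obtain xs where xs: "w = word n \<alpha> xs (ext_basis {})" "set xs \<subseteq> {1..n}" "length xs = card U"
        using w by blast
      have "wedge (gen_vec n \<alpha> i) w \<in> ?W (Suc (card U))" if "i \<in> {1..n}" for i
        using xs that by (auto intro!: exI[of _ "i # xs"])
      then show ?thesis
        unfolding j l.sum l.scaleR by (intro span_sum span_scale span_base)
    qed
    have "wedge (ext_basis {j}) (ext_basis U) \<in> wedge (ext_basis {j}) ` span (?W (card U))"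
      using insert by auto
    also have "\<dots> = span (wedge (ext_basis {j}) ` ?W (card U))"
      by (rule linear_span_image[OF linear_wedge_right, symmetric])
    also have "\<dots> \<subseteq> span (?W (Suc (card U)))"
      by (rule span_minimal) (use step in auto)
    finally have "wedge (ext_basis {j}) (ext_basis U) \<in> span (?W (Suc (card U)))" .
    \<comment> \<open>The sign is 1 or -1, hence its own inverse, and can be moved to the other
      side.\<close>
    moreover have "ext_basis (insert j U) =
        shuffle_sign {j} U *\<^sub>R wedge (ext_basis {j}) (ext_basis U)"
      using insert.hyps by (simp add: wedge_ext_basis wedge_basis_def shuffle_sign_singleton flip: power_add)
    ultimately show ?case using insert.hyps by (simp add: span_scale)
  qed
qed

section \<open>The lexicographic order and leading vectors\<close>

text \<open>The witness \<open>a\<close>, the first place where the sets differ, is the minimum of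
  the symmetric difference.\<close>

lemma lex_less_iff:
  assumes "finite S" "finite T"
  shows "lex_less S T \<longleftrightarrow> (\<exists>a\<in>S - T. \<forall>x<a. x \<in> S \<longleftrightarrow> x \<in> T)"
proof
  assume l: "lex_less S T"
  then have "sym_diff S T \<noteq> {}" by (auto simp: lex_less_def)
  then have "Min (sym_diff S T) \<in> sym_diff S T" using assms by (intro Min_in) auto
  moreover have "x \<in> S \<longleftrightarrow> x \<in> T" if "x < Min (sym_diff S T)" for x
    using that assms by (metis Diff_iff Min_gr_iff UnI1 UnI2 empty_iff finite_Diff finite_UnI order_less_irrefl)
  ultimately show "\<exists>a\<in>S - T. \<forall>x<a. x \<in> S \<longleftrightarrow> x \<in> T"
    using l by (auto simp: lex_less_def)
next
  assume "\<exists>a\<in>S - T. \<forall>x<a. x \<in> S \<longleftrightarrow> x \<in> T"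
  then obtain a where a: "a \<in> S" "a \<notin> T" "\<forall>x<a. x \<in> S \<longleftrightarrow> x \<in> T" by blast
  have "Min (sym_diff S T) = a"
    using assms a by (intro Min_eqI) (auto intro: leI)
  then show "lex_less S T" using a by (auto simp: lex_less_def)
qed

lemma lex_less_irrefl: "\<not> lex_less S S"
  by (simp add: lex_less_def)

lemma lex_less_trans:
  assumes "finite S" "finite T" "finite U" "lex_less S T" "lex_less T U"
  shows "lex_less S U"
proof -
  obtain a where a: "a \<in> S" "a \<notin> T" "\<forall>x<a. x \<in> S \<longleftrightarrow> x \<in> T"
    using assms lex_less_iff by blast
  obtain b where b: "b \<in> T" "b \<notin> U" "\<forall>x<b. x \<in> T \<longleftrightarrow> x \<in> U"
    using assms lex_less_iff by blast
  \<comment> \<open>The smaller of the two first differences is the first difference of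
    \<open>S\<close> and \<open>U\<close>.\<close>
  have "min a b \<in> S - U \<and> (\<forall>x<min a b. x \<in> S \<longleftrightarrow> x \<in> U)"
    using a b by (cases a b rule: linorder_cases) auto
  then show ?thesis using assms lex_less_iff by blast
qed

lemma lex_less_linear:
  assumes "finite S" "finite T" "S \<noteq> T"
  shows "lex_less S T \<or> lex_less T S"
proof -
  have "Min (sym_diff S T) \<in> sym_diff S T" using assms by (intro Min_in) auto
  then show ?thesis using assms(3) by (auto simp: lex_less_def Un_commute)
qed

section \<open>Initial segments and the lexicographic order\<close>

lemma init_seg_facts:
  assumes "finite T" "k \<le> card T"
  shows init_seg_subset: "init_seg k T \<subseteq> T"
    and card_init_seg: "card (init_seg k T) = k"
    and init_seg_less: "x \<in> init_seg k T \<Longrightarrow> y \<in> T - init_seg k T \<Longrightarrow> x < y"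
    and sorted_list_init_seg: "sorted_list_of_set T =
      sorted_list_of_set (init_seg k T) @ sorted_list_of_set (T - init_seg k T)"
proof -
  let ?xs = "sorted_list_of_set T"
  have T: "set ?xs = T" "distinct ?xs" "sorted_wrt (<) ?xs" "length ?xs = card T"
    using assms by auto
  have d: "set (take k ?xs) \<union> set (drop k ?xs) = T"
    using T(1) by (metis append_take_drop_id set_append)
  have disj: "set (take k ?xs) \<inter> set (drop k ?xs) = {}"
    using T(2) by (metis append_take_drop_id distinct_append)
  have rest: "T - init_seg k T = set (drop k ?xs)"
    using d disj by (auto simp: init_seg_def)
  have sw: "sorted_wrt (<) (take k ?xs @ drop k ?xs)" using T(3) by simp
  show "init_seg k T \<subseteq> T" using d by (auto simp: init_seg_def)
  show "card (init_seg k T) = k"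
    using T assms(2) by (simp add: init_seg_def distinct_card)
  show "x < y" if "x \<in> init_seg k T" "y \<in> T - init_seg k T"
  proof -
    have "\<forall>x\<in>set (take k ?xs). \<forall>y\<in>set (drop k ?xs). x < y"
      using sw unfolding sorted_wrt_append by (elim conjE)
    then show ?thesis using that unfolding rest by (simp add: init_seg_def)
  qed
  have "sorted_list_of_set (init_seg k T) = take k ?xs" "sorted_list_of_set (set (drop k ?xs)) = drop k ?xs"
    unfolding init_seg_def by (auto intro!: sorted_list_of_set.idem_if_sorted_distinct sorted_wrt_take sorted_wrt_drop)
  then show "?xs = sorted_list_of_set (init_seg k T) @ sorted_list_of_set (T - init_seg k T)"
    unfolding rest by simp
qed

text \<open>If \<open>R\<close> came strictly earlier, the first disagreement \<open>a\<close> would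
  lie in \<open>T\<close> beyond the segment. The whole segment is then below \<open>a\<close>,
  where it agrees with \<open>R\<close>, so it is contained in \<open>R\<close> and equal to it by
  size.\<close>

lemma init_seg_lex_least:
  assumes "finite T" "R \<subseteq> T"
  shows "init_seg (card R) T = R \<or> lex_less (init_seg (card R) T) R"
proof (rule ccontr)
  let ?I = "init_seg (card R) T"
  have k: "card R \<le> card T" using assms by (simp add: card_mono)
  note I = init_seg_facts[OF assms(1) k]
  have fin: "finite R" "finite ?I" using assms I(1) finite_subset by blast+
  assume "\<not> (?I = R \<or> lex_less ?I R)"
  then have "?I \<noteq> R" "lex_less R ?I" using lex_less_linear[OF fin] by auto
  then obtain a where a: "a \<in> R" "a \<notin> ?I" "\<forall>x<a. x \<in> R \<longleftrightarrow> x \<in> ?I"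
    using lex_less_iff[OF fin] by blast
  have "x < a" if "x \<in> ?I" for x using I(3)[OF that] a assms(2) by blast
  then have "?I \<subseteq> R" using a(3) by blast
  then have "?I = R" using I(2) fin by (simp add: card_subset_eq)
  then show False using \<open>?I \<noteq> R\<close> by simp
qed

lemma init_seg_mono:
  assumes "finite S" "finite T" "k \<le> card S" "k \<le> card T" "lex_less S T"
  shows "init_seg k S = init_seg k T \<or> lex_less (init_seg k S) (init_seg k T)"
proof (rule ccontr)
  let ?I = "init_seg k S" and ?J = "init_seg k T"
  note I = init_seg_facts[OF assms(1,3)] and J = init_seg_facts[OF assms(2,4)]
  have fin: "finite ?I" "finite ?J" using assms I(1) J(1) finite_subset by blast+
  assume "\<not> (?I = ?J \<or> lex_less ?I ?J)"
  then have ne: "?I \<noteq> ?J" and "lex_less ?J ?I" using lex_less_linear[OF fin] by auto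
  then obtain c where c: "c \<in> ?J" "c \<notin> ?I" "\<forall>x<c. x \<in> ?I \<longleftrightarrow> x \<in> ?J"
    using lex_less_iff[OF fin(2,1)] by blast
  obtain a where a: "a \<in> S" "a \<notin> T" "\<forall>x<a. x \<in> S \<longleftrightarrow> x \<in> T"
    using assms lex_less_iff by blast
  have "c \<noteq> a" using a c J(1) by blast
  \<comment> \<open>Whichever of \<open>a\<close> and \<open>c\<close> is smaller lies in
    \<open>S\<close> but beyond \<open>?I\<close>, so all of \<open>?I\<close> lies below it; there
    \<open>S\<close> agrees with \<open>T\<close> and \<open>?I\<close> agrees with
    \<open>?J\<close>. This forces \<open>?I \<subseteq> ?J\<close>, and the sizes are
    equal.\<close>
  have "x < c \<and> x \<in> T" if x: "x \<in> ?I" for x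
  proof (cases "c < a")
    case True
    then have "c \<in> S - ?I" using a c J(1) by blast
    then have "x < c" using I(3)[OF x] by blast
    then show ?thesis using True a x I(1) by auto
  next
    case False
    then have "a < c" using \<open>c \<noteq> a\<close> by auto
    then have "a \<in> S - ?I" using a c J(1) by blast
    then have "x < a" using I(3)[OF x] by blast
    then show ?thesis using \<open>a < c\<close> a x I(1) by auto
  qed
  then have "?I \<subseteq> ?J" using c by blast
  then have "?I = ?J" using I(2) J(2) fin by (simp add: card_subset_eq)
  then show False using ne by simp
qed

section \<open>Greedy bases and dimensions\<close>

text \<open>Greedy selection along the order \<open>R\<close> on \<open>F\<close>, restricted to a
  finite initial segment \<open>P\<close>. The greatest element is peeled off: its vector is kept
  iff it lies outside the span of the rest. Injectivity is carried along so that indices, and not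
  only vectors, can be counted.\<close>

lemma leading_vectors_basis:
  fixes g :: "'b \<Rightarrow> 'a::real_vector"
  assumes "finite P"
    and trans: "transp_on F R" and asym: "asymp_on F R" and total: "totalp_on F R"
    and "P \<subseteq> F"
    and "\<And>S T. S \<in> F \<Longrightarrow> T \<in> P \<Longrightarrow> R S T \<Longrightarrow> S \<in> P"
  defines "B \<equiv> \<lambda>P. {S\<in>P. g S \<notin> span (g ` {T\<in>F. R T S})}"
  shows "inj_on g (B P) \<and> independent (g ` B P) \<and> span (g ` B P) = span (g ` P)"
  using assms(1,5,6)
proof (induction "card P" arbitrary: P)
  case 0
  then show ?case by (simp add: B_def independent_empty)
next
  case (Suc k)
  have "transp_on P R" "asymp_on P R"
    using trans asym Suc.prems(2) by (auto intro: transp_on_subset asymp_on_subset)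
  moreover have "P \<noteq> {}" using Suc.hyps by auto
  ultimately obtain m where m: "m \<in> P" "\<And>x. x \<in> P \<Longrightarrow> x \<noteq> m \<Longrightarrow> \<not> R m x"
    using Finite_Set.bex_max_element[OF Suc.prems(1)] by metis
  let ?Q = "P - {m}"
  \<comment> \<open>Closure of \<open>P\<close> under predecessors gives one inclusion; maximality
    of \<open>m\<close> together with totality gives the other.\<close>
  have below: "{T\<in>F. R T m} = ?Q"
  proof (intro equalityI subsetI)
    fix T assume "T \<in> {T\<in>F. R T m}"
    then show "T \<in> ?Q" using m Suc.prems(2,3) asymp_onD[OF asym] by blast
  next
    fix T assume "T \<in> ?Q"
    then show "T \<in> {T\<in>F. R T m}" using m Suc.prems(2) totalp_onD[OF total] by blast
  qed
  have "inj_on g (B ?Q) \<and> independent (g ` B ?Q) \<and> span (g ` B ?Q) = span (g ` ?Q)"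
  proof (rule Suc.hyps)
    show "k = card ?Q" using Suc.hyps Suc.prems m by simp
    show "S \<in> ?Q" if "S \<in> F" "T \<in> ?Q" "R S T" for S T
      using that m Suc.prems(3)[of S T] by blast
  qed (use Suc.prems in auto)
  then have IH: "inj_on g (B ?Q)" "independent (g ` B ?Q)" "span (g ` B ?Q) = span (g ` ?Q)"
    by auto
  have img: "g ` P = insert (g m) (g ` ?Q)" using m by auto
  show ?case
  proof (cases "g m \<in> span (g ` ?Q)")
    case True
    then have "g m \<in> span (g ` {T\<in>F. R T m})" unfolding below .
    then have "B P = B ?Q" unfolding B_def by blast
    then show ?thesis using IH True unfolding img by (simp add: span_redundant)
  next
    case False
    then have "g m \<notin> span (g ` {T\<in>F. R T m})" unfolding below .
    then have B: "B P = insert m (B ?Q)" unfolding B_def using m(1) by blast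
    have "g m \<notin> span (g ` B ?Q)" using False IH by simp
    then have "g m \<notin> g ` B ?Q" using span_base[of "g m" "g ` B ?Q"] by argo
    moreover have "span (insert (g m) (g ` B ?Q)) = span (insert (g m) (g ` ?Q))"
      unfolding span_insert IH(3) ..
    ultimately show ?thesis using IH \<open>g m \<notin> span (g ` B ?Q)\<close>
      unfolding B img by (auto simp: inj_on_insert independent_insert)
  qed
qed

lemma card_leading_vectors:
  fixes g :: "'b \<Rightarrow> 'a::real_vector"
  assumes "finite P"
    and "transp_on F R" and "asymp_on F R" and "totalp_on F R"
    and "P \<subseteq> F"
    and "\<And>S T. S \<in> F \<Longrightarrow> T \<in> P \<Longrightarrow> R S T \<Longrightarrow> S \<in> P"
  shows "card {S\<in>P. g S \<notin> span (g ` {T\<in>F. R T S})} = dim (g ` P)"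
proof -
  let ?B = "{S\<in>P. g S \<notin> span (g ` {T\<in>F. R T S})}"
  have "inj_on g ?B \<and> independent (g ` ?B) \<and> span (g ` ?B) = span (g ` P)"
    by (rule leading_vectors_basis[where F = F and R = R]) (use assms in blast)+
  then have B: "inj_on g ?B" "independent (g ` ?B)" "span (g ` ?B) = span (g ` P)"
    by blast+
  then show ?thesis using dim_eq_card[OF B(3,2)] by (simp add: card_image)
qed

text \<open>A relation \<open>c = b + c'\<close> would place \<open>b\<close> in both spans, so
  \<open>b = 0\<close>, and \<open>c\<close> would already depend on \<open>C\<close>.\<close>

lemma independent_Un_trivial_Int:
  fixes B C :: "'a::real_vector set"
  assumes "independent B" "finite C" "independent C" "span B \<inter> span C \<subseteq> {0}"
  shows "independent (B \<union> C)"
  using assms(2-)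
proof (induction C)
  case (insert c C)
  have C: "independent C" "c \<notin> span C"
    using insert.prems insert.hyps by (auto simp: independent_insert)
  have "c \<notin> span (B \<union> C)"
  proof
    assume "c \<in> span (B \<union> C)"
    then obtain b c' where bc: "c = b + c'" "b \<in> span B" "c' \<in> span C" unfolding span_Un by auto
    have "c - c' \<in> span (insert c C)"
      using bc by (intro span_diff span_base[of c]) (auto intro: span_mono[THEN subsetD])
    then have "b \<in> span B \<inter> span (insert c C)" using bc by simp
    then have "b = 0" using insert.prems by blast
    then show False using bc C by simp
  qed
  moreover have "span C \<subseteq> span (insert c C)" by (rule span_mono) auto
  then have "independent (B \<union> C)" using insert C by auto
  ultimately show ?case by (auto simp: independent_insert span_base)
qed (use assms in auto)

lemma dim_Un_trivial_Int:
  fixes X Y :: "'a::real_vector set"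
  assumes "finite X" "finite Y" "span X \<inter> span Y \<subseteq> {0}"
  shows "dim (X \<union> Y) = dim X + dim Y"
proof -
  obtain B where B: "B \<subseteq> X" "independent B" "X \<subseteq> span B" "card B = dim X" using basis_exists by metis
  obtain C where C: "C \<subseteq> Y" "independent C" "Y \<subseteq> span C" "card C = dim Y" using basis_exists by metis
  have fin: "finite B" "finite C" using assms(1,2) B(1) C(1) by (auto intro: finite_subset)
  have BC: "span B \<inter> span C \<subseteq> {0}" using B C assms(3) span_mono by blast
  \<comment> \<open>A common basis vector would be 0, which no independent set contains.\<close>
  have "B \<inter> C = {}"
    using BC B(2) dependent_zero span_base by blast
  moreover have "independent (B \<union> C)"
    by (rule independent_Un_trivial_Int) (use B C fin BC in auto)
  moreover have "X \<union> Y \<subseteq> span (B \<union> C)"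
    using B C span_mono[of B "B \<union> C"] span_mono[of C "B \<union> C"] by blast
  moreover have "B \<union> C \<subseteq> X \<union> Y" using B(1) C(1) by blast
  ultimately have "card (B \<union> C) = dim (X \<union> Y)" by (intro basis_card_eq_dim)
  then show ?thesis
    using \<open>B \<inter> C = {}\<close> B C fin by (simp add: card_Un_disjoint)
qed

section \<open>Counting faces of the shifted complex\<close>

text \<open>A model of the quotient map: on \<open>ext_alg n\<close> its kernel is the non-face
  ideal. Ranks in the quotients for \<open>K\<close>, \<open>L\<close> and
  \<open>K \<union> L\<close> thereby become dimensions inside one vector space and can be
  compared.\<close>

definition face_proj :: "nat set set \<Rightarrow> ext \<Rightarrow> ext" where
  "face_proj K x = (\<Sum>S\<in>Poly_Mapping.keys x \<inter> K. Poly_Mapping.lookup x S *\<^sub>R ext_basis S)"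

lemma lookup_face_proj:
  "Poly_Mapping.lookup (face_proj K x) T = (if T \<in> K then Poly_Mapping.lookup x T else 0)"
proof -
  have "Poly_Mapping.lookup (face_proj K x) T =
      (\<Sum>S\<in>Poly_Mapping.keys x \<inter> K. if S = T then Poly_Mapping.lookup x T else 0)"
    unfolding face_proj_def lookup_sum
    by (intro sum.cong refl) (simp add: ext_basis_def lookup_single when_def)
  then show ?thesis by (simp add: in_keys_iff)
qed

lemma linear_face_proj: "linear (face_proj K)"
  by (intro linearI poly_mapping_eqI) (auto simp: lookup_face_proj lookup_add)

lemma face_proj_eq_0_iff: "face_proj K x = 0 \<longleftrightarrow> Poly_Mapping.keys x \<inter> K = {}"
  by (auto simp: poly_mapping_eq_iff fun_eq_iff lookup_face_proj in_keys_iff)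

text \<open>Supersets of non-faces are non-faces, so the vectors supported on non-faces form an
  ideal containing the generators. Conversely, each such vector is a linear combination of
  generators.\<close>

lemma nonface_ideal_eq:
  assumes "abstract_simplicial_complex K"
  shows "nonface_ideal n K = {x \<in> ext_alg n. face_proj K x = 0}" (is "_ = ?I")
proof
  let ?G = "ext_basis ` {T. T \<subseteq> {1..n} \<and> T \<notin> K}"
  have down: "T \<in> K" if "S \<in> K" "T \<subseteq> S" for S T
    using assms that by (auto simp: abstract_simplicial_complex_def)
  have "subspace ?I"
    using subspace_ext_alg[of n] linear_face_proj[of K]
    by (auto simp: subspace_def linear_add linear_scale linear_0)
  moreover have "wedge x y \<in> ?I \<and> wedge y x \<in> ?I" if "x \<in> ext_alg n" "y \<in> ?I" for x y
  proof -
    have y: "y \<in> ext_alg n" "Poly_Mapping.keys y \<inter> K = {}"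
      using that by (auto simp: face_proj_eq_0_iff)
    have "S \<notin> K" if S: "S \<in> Poly_Mapping.keys (wedge x y) \<union> Poly_Mapping.keys (wedge y x)" for S
    proof -
      obtain T where "T \<in> Poly_Mapping.keys y" "T \<subseteq> S"
        using S keys_wedge[of x y] keys_wedge[of y x] by blast
      then show ?thesis using y(2) down by blast
    qed
    then show ?thesis
      using that(1) y(1) by (auto simp: face_proj_eq_0_iff intro: wedge_in_ext_alg)
  qed
  ultimately have "ext_ideal n ?I" by (auto simp: ext_ideal_def)
  moreover have "?G \<subseteq> ?I"
    by (auto simp: face_proj_eq_0_iff ext_alg_def ext_basis_def)
  ultimately show "nonface_ideal n K \<subseteq> ?I"
    unfolding nonface_ideal_def by (simp add: hull_minimal)
  show "?I \<subseteq> nonface_ideal n K"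
    unfolding nonface_ideal_def hull_def
  proof (intro subsetI InterI)
    fix x J assume x: "x \<in> ?I" and J: "J \<in> {t. ext_ideal n t \<and> ?G \<subseteq> t}"
    have "S \<in> {T. T \<subseteq> {1..n} \<and> T \<notin> K}" if "S \<in> Poly_Mapping.keys x" for S
      using that x unfolding face_proj_eq_0_iff ext_alg_def by blast
    then have "ext_basis S \<in> J" if "S \<in> Poly_Mapping.keys x" for S
      using that J by blast
    moreover have "subspace J" using J by (simp add: ext_ideal_def)
    ultimately have "(\<Sum>S\<in>Poly_Mapping.keys x. Poly_Mapping.lookup x S *\<^sub>R ext_basis S) \<in> J"
      by (intro subspace_sum subspace_scale)
    then show "x \<in> J" using ext_eq_sum_basis[of "Poly_Mapping.keys x" x] by simp
  qed
qed

lemma residue_class_eq_iff: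
  assumes "abstract_simplicial_complex K" "x \<in> ext_alg n" "y \<in> ext_alg n"
  shows "residue_class n K x = residue_class n K y \<longleftrightarrow> face_proj K x = face_proj K y"
proof -
  have rc: "residue_class n K z = {w \<in> ext_alg n. face_proj K w = face_proj K z}"
    if "z \<in> ext_alg n" for z
    using that subspace_diff[OF subspace_ext_alg, of _ n z]
    by (auto simp: residue_class_def nonface_ideal_eq[OF assms(1)] linear_diff[OF linear_face_proj])
  show ?thesis using assms(2,3) by (auto simp: rc)
qed

lemma gen_wedge_in_ext_alg: "gen_wedge n \<alpha> S \<in> ext_alg n"
  unfolding gen_wedge_eq_word by (intro word_in_ext_alg ext_basis_in_ext_alg) simp

text \<open>Residue classes agree iff the projections do, and the linear map
  \<open>face_proj K\<close> commutes with \<open>span\<close>.\<close>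

lemma mem_alg_shift_iff:
  assumes "abstract_simplicial_complex K" "S \<subseteq> {1..n}"
  shows "S \<in> alg_shift n \<alpha> K \<longleftrightarrow> face_proj K (gen_wedge n \<alpha> S) \<notin>
    span ((\<lambda>T. face_proj K (gen_wedge n \<alpha> T)) ` {T. T \<subseteq> {1..n} \<and> card T = card S \<and> lex_less T S})"
proof -
  let ?E = "{T. T \<subseteq> {1..n} \<and> card T = card S \<and> lex_less T S}"
  have "span (gen_wedge n \<alpha> ` ?E) \<subseteq> ext_alg n"
    by (rule span_minimal[OF _ subspace_ext_alg]) (auto intro: gen_wedge_in_ext_alg)
  then have "residue_class n K (gen_wedge n \<alpha> S) \<in> residue_class n K ` span (gen_wedge n \<alpha> ` ?E) \<longleftrightarrow>
      face_proj K (gen_wedge n \<alpha> S) \<in> face_proj K ` span (gen_wedge n \<alpha> ` ?E)"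
    unfolding image_iff
    by (intro bex_cong refl residue_class_eq_iff[OF assms(1) gen_wedge_in_ext_alg]) blast
  also have "face_proj K ` span (gen_wedge n \<alpha> ` ?E) = span (face_proj K ` gen_wedge n \<alpha> ` ?E)"
    by (rule linear_span_image[OF linear_face_proj, symmetric])
  finally show ?thesis using assms(2) by (simp add: alg_shift_def image_image)
qed

section \<open>Counting over lexicographically closed families\<close>

definition lex_closed :: "nat \<Rightarrow> nat \<Rightarrow> nat set set \<Rightarrow> bool" where
  "lex_closed n k \<R> \<longleftrightarrow> (\<forall>R\<in>\<R>. R \<subseteq> {1..n} \<and> card R = k) \<and>
     (\<forall>R\<in>\<R>. \<forall>R'. R' \<subseteq> {1..n} \<and> card R' = k \<and> lex_less R' R \<longrightarrow> R' \<in> \<R>)"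

lemma lex_closed_subset: "lex_closed n k \<R> \<Longrightarrow> R \<in> \<R> \<Longrightarrow> R \<subseteq> {1..n}"
  unfolding lex_closed_def by blast

lemma lex_closedD:
  assumes "lex_closed n k \<R>" "R \<in> \<R>" "R' \<subseteq> {1..n}" "card R' = k" "R' = R \<or> lex_less R' R"
  shows "R' \<in> \<R>"
  using assms unfolding lex_closed_def by metis

text \<open>The two families differ only in \<open>A\<close>, so the difference of their counts
  isolates the sets with initial segment \<open>A\<close>.\<close>

lemma lex_closed_lessI:
  assumes "A \<subseteq> {1..n}"
  defines "\<R> \<equiv> {R. R \<subseteq> {1..n} \<and> card R = card A \<and> lex_less R A}"
  shows "lex_closed n (card A) \<R>" and "lex_closed n (card A) (insert A \<R>)"
proof -
  have "lex_less R' A" if "lex_less R' R" "lex_less R A" "R' \<subseteq> {1..n}" "R \<subseteq> {1..n}" for R R'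
    using that assms(1) lex_less_trans[of R' R A] by (meson finite_atLeastAtMost finite_subset)
  then show "lex_closed n (card A) \<R>" "lex_closed n (card A) (insert A \<R>)"
    using assms(1) by (auto simp: lex_closed_def \<R>_def)
qed

text \<open>For a family \<R> of \<open>k\<close>-sets this is the union of the \<open>I_R^i\<close>
  over all \<open>R\<close> in \<R>.\<close>

definition init_in :: "nat \<Rightarrow> nat \<Rightarrow> nat \<Rightarrow> nat set set \<Rightarrow> nat set set" where
  "init_in n k i \<R> = {T. T \<subseteq> {1..n} \<and> card T = k + i \<and> init_seg k T \<in> \<R>}"

text \<open>By \<open>init_seg_mono\<close> these sets form an initial segment of the lexicographic
  order on sets of size \<open>k + i\<close>, so the members of the shifted complex among them index
  a greedy basis.\<close>

lemma card_init_in_alg_shift: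
  assumes "abstract_simplicial_complex K" "lex_closed n k \<R>"
  shows "card (init_in n k i \<R> \<inter> alg_shift n \<alpha> K) =
    dim ((\<lambda>T. face_proj K (gen_wedge n \<alpha> T)) ` init_in n k i \<R>)"
proof -
  let ?g = "\<lambda>T. face_proj K (gen_wedge n \<alpha> T)"
  let ?F = "{T. T \<subseteq> {1..n} \<and> card T = k + i}" and ?P = "init_in n k i \<R>"
  have finT: "finite T" if "T \<in> ?F" for T using that finite_subset by blast
  have "?P \<subseteq> Pow {1..n}" by (auto simp: init_in_def)
  then have "finite ?P" by (rule finite_subset) simp
  moreover have "transp_on ?F lex_less"
    by (rule transp_onI) (metis finT lex_less_trans)
  moreover have "asymp_on ?F lex_less"
    by (rule asymp_onI) (metis finT lex_less_trans lex_less_irrefl)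
  moreover have "totalp_on ?F lex_less" 
    by (rule totalp_onI) (metis finT lex_less_linear)
  moreover have "?P \<subseteq> ?F" by (auto simp: init_in_def)
  moreover have "S \<in> ?P" if "S \<in> ?F" "T \<in> ?P" "lex_less S T" for S T
  proof -
    have S: "S \<subseteq> {1..n}" "card S = k + i" and T: "T \<subseteq> {1..n}" "card T = k + i" "init_seg k T \<in> \<R>"
      using that by (simp_all add: init_in_def)
    have fin: "finite S" "finite T" using S T finite_subset by blast+
    have c: "k \<le> card S" "k \<le> card T" using S T by simp_all
    have "init_seg k S \<subseteq> {1..n}" "card (init_seg k S) = k"
      using S init_seg_subset[OF fin(1) c(1)] card_init_seg[OF fin(1) c(1)] by simp_all
    moreover have "init_seg k S = init_seg k T \<or> lex_less (init_seg k S) (init_seg k T)"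
      using init_seg_mono[OF fin c] that(3) .
    ultimately have "init_seg k S \<in> \<R>" by (rule lex_closedD[OF assms(2) T(3)])
    then show ?thesis using S by (simp add: init_in_def)
  qed
  ultimately have "card {S\<in>?P. ?g S \<notin> span (?g ` {T\<in>?F. lex_less T S})} = dim (?g ` ?P)"
    by (rule card_leading_vectors)
  moreover have "?P \<inter> alg_shift n \<alpha> K = {S\<in>?P. ?g S \<notin> span (?g ` {T\<in>?F. lex_less T S})}"
    using mem_alg_shift_iff[OF assms(1), of _ n \<alpha>] by (auto simp: init_in_def conj_assoc)
  ultimately show ?thesis by simp
qed

text \<open>The tail of a product may be written in either basis. Forwards, \<open>f_T\<close>
  splits at its first \<open>k\<close> letters and the rest is expanded in basis vectors. Backwards,
  \<open>ext_basis U\<close> is expanded in words; closure of \<R> absorbs the products whose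
  initial segment has moved.\<close>

lemma span_gen_wedge_init_in:
  assumes "generic_matrix n \<alpha>" and \<R>: "lex_closed n k \<R>"
  shows "span (gen_wedge n \<alpha> ` init_in n k i \<R>) =
    span {word n \<alpha> (sorted_list_of_set R) (ext_basis U) | R U. R \<in> \<R> \<and> U \<subseteq> {1..n} \<and> card U = i}"
    (is "span ?X = span ?Y")
proof (rule subset_antisym; rule span_minimal; (rule subspace_span)?; rule subsetI)
  fix x assume "x \<in> ?X"
  then obtain T where T: "x = gen_wedge n \<alpha> T" "T \<subseteq> {1..n}" "card T = k + i" "init_seg k T \<in> \<R>"
    by (auto simp: init_in_def)
  let ?R = "init_seg k T" and ?U = "T - init_seg k T"
  let ?w = "word n \<alpha> (sorted_list_of_set ?R)"
  have fin: "finite T" using T finite_subset by blast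
  have k: "k \<le> card T" using T by simp
  note init = init_seg_subset[OF fin k] card_init_seg[OF fin k]
  have card_U: "card ?U = i" using init fin T by (simp add: card_Diff_subset finite_subset)
  let ?u = "gen_wedge n \<alpha> ?U"
  \<comment> \<open>A word of length \<open>i\<close> applied to the unit is homogeneous of degree
    \<open>i\<close>.\<close>
  have keys: "V \<subseteq> {1..n} \<and> card V = i" if "V \<in> Poly_Mapping.keys ?u" for V
    using that keys_word[of V n \<alpha> "sorted_list_of_set ?U" "ext_basis {}"]
      gen_wedge_in_ext_alg[of n \<alpha> ?U] card_U
    by (auto simp: gen_wedge_eq_word ext_basis_def ext_alg_def)
  interpret w: linear ?w by (rule linear_word)
  have "x = ?w ?u"
    using T sorted_list_init_seg[OF fin k] by (simp add: gen_wedge_eq_word)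
  also have "\<dots> = ?w (\<Sum>V\<in>Poly_Mapping.keys ?u. Poly_Mapping.lookup ?u V *\<^sub>R ext_basis V)"
    using ext_eq_sum_basis[of "Poly_Mapping.keys ?u" ?u] by simp
  also have "\<dots> = (\<Sum>V\<in>Poly_Mapping.keys ?u. Poly_Mapping.lookup ?u V *\<^sub>R ?w (ext_basis V))"
    by (simp add: w.sum w.scaleR)
  also have "\<dots> \<in> span ?Y"
    using keys T(4) by (intro span_sum span_scale span_base) blast
  finally show "x \<in> span ?Y" .
next
  fix y assume "y \<in> ?Y"
  then obtain R U where y: "y = word n \<alpha> (sorted_list_of_set R) (ext_basis U)"
    and R: "R \<in> \<R>" and U: "U \<subseteq> {1..n}" "card U = i" by blast
  have Rn: "R \<subseteq> {1..n}" "card R = k" using R \<R> by (auto simp: lex_closed_def)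
  have finR: "finite R" using Rn finite_subset by blast
  let ?w = "word n \<alpha> (sorted_list_of_set R)"
  let ?W = "{word n \<alpha> xs (ext_basis {}) | xs. set xs \<subseteq> {1..n} \<and> length xs = i}"
  obtain c where "\<And>j k. j \<in> {1..n} \<Longrightarrow> k \<in> {1..n} \<Longrightarrow>
      (\<Sum>i\<in>{1..n}. c j i * \<alpha> (i, k)) = (if j = k then 1 else 0)"
    using generic_matrix_left_inverse[OF assms(1)] by metis
  then have "ext_basis U \<in> span ?W"
    using ext_basis_in_span_words[of n c \<alpha> U] U by simp
  then have "y \<in> ?w ` span ?W" using y by blast
  also have "\<dots> = span (?w ` ?W)"
    by (rule linear_span_image[OF linear_word, symmetric])
  also have "\<dots> \<subseteq> span ?X"
  proof (rule span_minimal[OF _ subspace_span], rule subsetI)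
    fix z assume "z \<in> ?w ` ?W"
    then obtain xs where z: "z = word n \<alpha> (sorted_list_of_set R @ xs) (ext_basis {})"
      and xs: "set xs \<subseteq> {1..n}" "length xs = i" by auto
    let ?zs = "sorted_list_of_set R @ xs"
    have e: "ext_basis {} \<in> ext_alg n" by (rule ext_basis_in_ext_alg) simp
    show "z \<in> span ?X"
    \<comment> \<open>A repeated letter kills the product; otherwise sorting turns it into a
      multiple of \<open>f_T\<close> with \<open>R \<subseteq> T\<close>.\<close>
    proof (cases "distinct ?zs")
      case False
      then show ?thesis using word_not_distinct[OF e False] z span_0 by metis
    next
      case True
      let ?T = "set ?zs"
      obtain c where c: "z = c *\<^sub>R gen_wedge n \<alpha> ?T"
        using word_sort[OF e True, of \<alpha>] z unfolding gen_wedge_eq_word by blast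
      have T: "?T \<subseteq> {1..n}" "R \<subseteq> ?T" using Rn xs finR by auto
      have card_T: "card ?T = k + i"
        using distinct_card[OF True] xs Rn by simp
      have kT: "k \<le> card ?T" using card_T by simp
      \<comment> \<open>Letters of \<open>xs\<close> may be smaller than elements of
        \<open>R\<close> and displace them, but the initial segment can only move down in the order,
        hence stays in \<R>.\<close>
      have "init_seg k ?T = R \<or> lex_less (init_seg k ?T) R"
        using init_seg_lex_least[OF finite_set T(2)] Rn by simp
      moreover have "init_seg k ?T \<subseteq> {1..n}" "card (init_seg k ?T) = k"
        using init_seg_subset[OF finite_set kT] card_init_seg[OF finite_set kT] T(1) by (blast, blast)
      ultimately have "init_seg k ?T \<in> \<R>" by (intro lex_closedD[OF \<R> R])
      then have "?T \<in> init_in n k i \<R>" using T(1) card_T unfolding init_in_def by blast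
      then have "gen_wedge n \<alpha> ?T \<in> ?X" by (rule imageI)
      then show ?thesis unfolding c by (intro span_scale span_base)
    qed
  qed
  finally show "y \<in> span ?X" .
qed

lemma dim_eq_if_span_eq: "span X = span Y \<Longrightarrow> dim X = dim (Y :: 'a::real_vector set)"
  by (metis dim_span)

section \<open>Additivity of ranks over two complexes\<close>

text \<open>Each \<open>y\<close> has a projection only on the side where \<open>U\<close> may be a
  face. The nonzero projections to \<open>K\<close> are supported off \<open>L\<close> and those to
  \<open>L\<close> are supported on \<open>L\<close>, so their spans meet in 0.\<close>

lemma dim_face_proj_Un:
  assumes K: "abstract_simplicial_complex K" and L: "abstract_simplicial_complex L"
    and "finite Y"
    and supp: "\<And>y. y \<in> Y \<Longrightarrow> \<exists>U. U \<notin> K \<inter> L \<and> (\<forall>S\<in>Poly_Mapping.keys y. U \<subseteq> S)"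
  shows "dim (face_proj (K \<union> L) ` Y) = dim (face_proj K ` Y) + dim (face_proj L ` Y)"
proof -
  have cases: "face_proj (K \<union> L) y = face_proj K y \<and> face_proj L y = 0 \<or>
      face_proj (K \<union> L) y = face_proj L y \<and> face_proj K y = 0" if y: "y \<in> Y" for y
  proof -
    obtain U where U: "U \<notin> K \<inter> L" "\<And>S. S \<in> Poly_Mapping.keys y \<Longrightarrow> U \<subseteq> S"
      using supp[OF y] by blast
    \<comment> \<open>A face of \<open>M\<close> in the support of \<open>y\<close> would contain
      \<open>U\<close> and so make \<open>U\<close> a face of \<open>M\<close>.\<close>
    have notin: "Poly_Mapping.lookup y S = 0"
      if "abstract_simplicial_complex M" "U \<notin> M" "S \<in> M" for M S
      using that U(2)[of S] by (auto simp: abstract_simplicial_complex_def in_keys_iff)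
    have "U \<notin> K \<or> U \<notin> L" using U(1) by blast
    then show ?thesis
    proof
      assume "U \<notin> K"
      then have "face_proj K y = 0" "face_proj (K \<union> L) y = face_proj L y"
        using notin[OF K] by (auto intro!: poly_mapping_eqI simp: lookup_face_proj)
      then show ?thesis by simp
    next
      assume "U \<notin> L"
      then have "face_proj L y = 0" "face_proj (K \<union> L) y = face_proj K y"
        using notin[OF L] by (auto intro!: poly_mapping_eqI simp: lookup_face_proj)
      then show ?thesis by simp
    qed
  qed
  have "span (face_proj (K \<union> L) ` Y) = span (face_proj K ` Y \<union> face_proj L ` Y)"
  proof (rule subset_antisym; rule span_minimal; (rule subspace_span)?)
    have "face_proj (K \<union> L) y \<in> face_proj K ` Y \<union> face_proj L ` Y" if "y \<in> Y" for y
      using cases[OF that] that by auto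
    then show "face_proj (K \<union> L) ` Y \<subseteq> span (face_proj K ` Y \<union> face_proj L ` Y)"
      using span_superset by blast
    have "face_proj K y \<in> span (face_proj (K \<union> L) ` Y) \<and> face_proj L y \<in> span (face_proj (K \<union> L) ` Y)"
      if y: "y \<in> Y" for y
    proof -
      have "face_proj (K \<union> L) y \<in> span (face_proj (K \<union> L) ` Y)"
        using y by (intro span_base imageI)
      then show ?thesis using cases[OF y] span_0 by auto
    qed
    then show "face_proj K ` Y \<union> face_proj L ` Y \<subseteq> span (face_proj (K \<union> L) ` Y)"
      by blast
  qed
  then have "dim (face_proj (K \<union> L) ` Y) = dim (face_proj K ` Y \<union> face_proj L ` Y)"
    by (rule dim_eq_if_span_eq)
  also have "\<dots> = dim (face_proj K ` Y) + dim (face_proj L ` Y)"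
  proof (rule dim_Un_trivial_Int)
    have supported: "span (face_proj M ` Y) \<subseteq> {x. Poly_Mapping.keys x \<subseteq> B}"
      if "\<And>y. y \<in> Y \<Longrightarrow> Poly_Mapping.keys (face_proj M y) \<subseteq> B" for M B
      using that by (intro span_minimal subspace_supported) blast
    have "Poly_Mapping.keys (face_proj K y) \<subseteq> - L" if "y \<in> Y" for y
    proof (cases "face_proj K y = 0")
      case False
      then have "Poly_Mapping.keys y \<inter> L = {}" using cases[OF that] face_proj_eq_0_iff by blast
      then show ?thesis by (auto simp: in_keys_iff lookup_face_proj split: if_splits)
    qed simp
    then have "span (face_proj K ` Y) \<subseteq> {x. Poly_Mapping.keys x \<subseteq> - L}" by (rule supported)
    moreover have "Poly_Mapping.keys (face_proj L y) \<subseteq> L" for y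
      by (auto simp: in_keys_iff lookup_face_proj split: if_splits)
    then have "span (face_proj L ` Y) \<subseteq> {x. Poly_Mapping.keys x \<subseteq> L}" by (intro supported)
    ultimately have "Poly_Mapping.keys x = {}" if "x \<in> span (face_proj K ` Y) \<inter> span (face_proj L ` Y)" for x
      using that by blast
    then show "span (face_proj K ` Y) \<inter> span (face_proj L ` Y) \<subseteq> {0}"
      using keys_eq_empty by blast
  qed (use assms(3) in auto)
  finally show ?thesis .
qed

text \<open>Both exchanges are combined: each count is the rank of the projected family
  \<open>?Y\<close>, which is the same for all three complexes, and every vector of
  \<open>?Y\<close> is supported on supersets of an \<open>i\<close>-set that is not a common
  face.\<close>

lemma card_init_in_alg_shift_Un:
  assumes K: "abstract_simplicial_complex K" and L: "abstract_simplicial_complex L"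
    and KL: "\<forall>S\<in>K \<inter> L. card S \<noteq> i"
    and gen: "generic_matrix n \<alpha>" and \<R>: "lex_closed n k \<R>"
  shows "card (init_in n k i \<R> \<inter> alg_shift n \<alpha> (K \<union> L)) =
    card (init_in n k i \<R> \<inter> alg_shift n \<alpha> K) + card (init_in n k i \<R> \<inter> alg_shift n \<alpha> L)"
proof -
  let ?Y = "{word n \<alpha> (sorted_list_of_set R) (ext_basis U) | R U. R \<in> \<R> \<and> U \<subseteq> {1..n} \<and> card U = i}"
  have dim: "card (init_in n k i \<R> \<inter> alg_shift n \<alpha> M) = dim (face_proj M ` ?Y)"
    if "abstract_simplicial_complex M" for M
  proof -
    have "span (face_proj M ` gen_wedge n \<alpha> ` init_in n k i \<R>) = span (face_proj M ` ?Y)"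
      unfolding linear_span_image[OF linear_face_proj] span_gen_wedge_init_in[OF gen \<R>] ..
    then show ?thesis
      unfolding card_init_in_alg_shift[OF that \<R>] image_image by (rule dim_eq_if_span_eq)
  qed
  have KLc: "abstract_simplicial_complex (K \<union> L)"
    using K L by (auto simp: abstract_simplicial_complex_def)
  have "?Y \<subseteq> (\<lambda>(R, U). word n \<alpha> (sorted_list_of_set R) (ext_basis U)) ` (Pow {1..n} \<times> Pow {1..n})"
  proof
    fix y assume "y \<in> ?Y"
    then obtain R U where "y = word n \<alpha> (sorted_list_of_set R) (ext_basis U)" "R \<in> \<R>" "U \<subseteq> {1..n}"
      by blast
    moreover from this have "R \<subseteq> {1..n}" using lex_closed_subset[OF \<R>] by blast
    ultimately show "y \<in> (\<lambda>(R, U). word n \<alpha> (sorted_list_of_set R) (ext_basis U)) ` (Pow {1..n} \<times> Pow {1..n})"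
      by (intro image_eqI[of _ _ "(R, U)"]) auto
  qed
  then have finY: "finite ?Y" by (rule finite_subset) simp
  have supp: "\<exists>U. card U = i \<and> (\<forall>S\<in>Poly_Mapping.keys y. U \<subseteq> S)" if "y \<in> ?Y" for y
  proof -
    obtain R U where "y = word n \<alpha> (sorted_list_of_set R) (ext_basis U)" "U \<subseteq> {1..n}" "card U = i"
      using \<open>y \<in> ?Y\<close> by blast
    then show ?thesis
      using keys_word[of _ n \<alpha> "sorted_list_of_set R" "ext_basis U"]
      by (intro exI[of _ U]) (auto simp: ext_basis_def dest: finite_subset)
  qed
  have "dim (face_proj (K \<union> L) ` ?Y) = dim (face_proj K ` ?Y) + dim (face_proj L ` ?Y)"
    by (rule dim_face_proj_Un[OF K L finY]) (use supp KL in blast)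
  then show ?thesis unfolding dim[OF KLc] dim[OF K] dim[OF L] .
qed

theorem theorem1p1:
  fixes K L :: "nat set set" and n :: nat and d :: int
    and \<alpha> :: "nat \<times> nat \<Rightarrow> real" and A :: "nat set"
  assumes "abstract_simplicial_complex K" and "abstract_simplicial_complex L"
    and "d = complex_dim (K \<inter> L)"
    and "vertices (K \<union> L) = {1..n}"
    and "generic_matrix n \<alpha>"
    and "A \<subseteq> {1..n}"
  shows "card (ext_sets n (nat (d + 2)) A \<inter> alg_shift n \<alpha> (K \<union> L)) =
         card (ext_sets n (nat (d + 2)) A \<inter> alg_shift n \<alpha> K) +
         card (ext_sets n (nat (d + 2)) A \<inter> alg_shift n \<alpha> L)"
proof -
  let ?i = "nat (d + 2)" and ?k = "card A"
  let ?lt = "{R. R \<subseteq> {1..n} \<and> card R = ?k \<and> lex_less R A}"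
  note closed = lex_closed_lessI[OF assms(6)]
  \<comment> \<open>\<open>complex_dim\<close> is the largest cardinality minus 1, so
    \<open>d + 2\<close> is that cardinality plus 1; it is positive, and \<open>nat\<close>
    truncates nothing.\<close>
  have "\<forall>S\<in>K \<inter> L. card S \<noteq> ?i"
  proof
    fix S assume S: "S \<in> K \<inter> L"
    have "finite (card ` (K \<inter> L))"
      using assms(1) by (auto simp: abstract_simplicial_complex_def)
    then have "card S \<le> Max (card ` (K \<inter> L))" using S by (intro Max_ge) auto
    then show "card S \<noteq> ?i" using assms(3) by (simp add: complex_dim_def)
  qed
  note Un = card_init_in_alg_shift_Un[OF assms(1,2) this assms(5)]
  \<comment> \<open>Subtraction on natural numbers truncates; the inequality \<open>le\<close> lets
    the difference of two sums split into the sum of two differences.\<close>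
  have diff: "card (ext_sets n ?i A \<inter> X) =
      card (init_in n ?k ?i (insert A ?lt) \<inter> X) - card (init_in n ?k ?i ?lt \<inter> X)"
    and le: "card (init_in n ?k ?i ?lt \<inter> X) \<le> card (init_in n ?k ?i (insert A ?lt) \<inter> X)" for X
  proof -
    have f: "finite (init_in n ?k ?i \<R>)" for \<R>
      by (rule finite_subset[of _ "Pow {1..n}"]) (auto simp: init_in_def)
    have sub: "init_in n ?k ?i ?lt \<inter> X \<subseteq> init_in n ?k ?i (insert A ?lt) \<inter> X"
      by (auto simp: init_in_def)
    \<comment> \<open>By irreflexivity \<open>A\<close> is not in \<open>?lt\<close>, so exactly the
      sets with initial segment \<open>A\<close> remain.\<close>
    have "ext_sets n ?i A \<inter> X = (init_in n ?k ?i (insert A ?lt) \<inter> X) - (init_in n ?k ?i ?lt \<inter> X)"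
      using lex_less_irrefl by (auto simp: ext_sets_def init_in_def)
    then show "card (ext_sets n ?i A \<inter> X) =
      card (init_in n ?k ?i (insert A ?lt) \<inter> X) - card (init_in n ?k ?i ?lt \<inter> X)"
      using sub f by (simp add: card_Diff_subset)
    show "card (init_in n ?k ?i ?lt \<inter> X) \<le> card (init_in n ?k ?i (insert A ?lt) \<inter> X)"
      using sub f by (intro card_mono) auto
  qed
  show ?thesis
    unfolding diff Un[OF closed(1)] Un[OF closed(2)]
    using le[of "alg_shift n \<alpha> K"] le[of "alg_shift n \<alpha> L"] by simp
qed

end
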